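(* Let $\epsilon>0$. For any $0<\alpha\le1$ and $\frac{\alpha}{2}\le\beta\le\alpha$ there is a regularly self-intersecting set system $\mathcal{F}$ with $$\lg S(\mathcal{F})\le\max\Big\{\alpha,\ (1-\alpha)+\alpha H\Big(\tfrac{\beta}{\alpha}\Big)\Big\}+\epsilon,\qquad \lg P(\mathcal{F})\le H(\alpha)-(1-\beta)H\Big(\tfrac{\alpha-\beta}{1-\beta}\Big)+\epsilon.$$
   Context: $\lg=\log_2$; $H(x)=-x\lg x-(1-x)\lg(1-x)$ is the binary entropy function (with $H(0)=H(1)=0$). A set system over $[n]$ is a family $\mathcal{F}\subseteq2^{[n]}$; isomorphic set systems differ by a bijective relabeling of $[n]$. A permutation $\pi$ of $[n]$ has prefix-sets $\{\pi(1),\dots,\pi(i)\}$, $0\le i\le n$, and is supported by $\mathcal{F}$ if all of them lie in $\mathcal{F}$. $C(\mathcal{F})$ is the number of chains $S_0\subsetneq\dots\subsetneq S_n$ of members of $\mathcal{F}$; $S(\mathcal{F})=|\mathcal{F}|^{1/n}$; $P(\mathcal{F})=(n!/C(\mathcal{F}))^{1/n}$ (or $+\infty$ if $C(\mathcal{F})=0$). $\mathcal{F}_1,\mathcal{F}_2$ on the same ground set are regularly intersecting if there is $\mathcal{G}\subseteq\mathcal{F}_1\cap\mathcal{F}_2$ such that every permutation supported by both has a prefix-set in $\mathcal{G}$ and every permutation supported by $\mathcal{F}_1$ but not $\mathcal{F}_2$ has no prefix-set in $\mathcal{G}$; $\mathcal{F}$ is regularly self-intersecting if it is regularly intersecting with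 every set system isomorphic to it. *)

theory Defs
  imports Complex_Main "HOL-Library.Extended_Real" "HOL-Combinatorics.Permutations"
begin

definition bin_entropy :: "real \<Rightarrow> real" where
  "bin_entropy x = (if x = 0 \<or> x = 1 then 0
     else - x * log 2 x - (1 - x) * log 2 (1 - x))"

text \<open>The ground set \<open>[n]\<close> is \<open>{1..n}\<close>. A family does not determine its ground set,
  so the notions below carry \<open>n\<close> as an explicit parameter.\<close>

definition set_system :: "nat \<Rightarrow> nat set set \<Rightarrow> bool" where
  "set_system n F \<longleftrightarrow> F \<subseteq> Pow {1..n}"

definition isomorphic_systems :: "nat \<Rightarrow> nat set set \<Rightarrow> nat set set \<Rightarrow> bool" where
  "isomorphic_systems n F F' \<longleftrightarrow> (\<exists>\<sigma>. \<sigma> permutes {1..n} \<and> F' = (\<lambda>X. \<sigma> ` X) ` F)"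

definition prefix_sets :: "nat \<Rightarrow> (nat \<Rightarrow> nat) \<Rightarrow> nat set set" where
  "prefix_sets n \<pi> = {\<pi> ` {1..i} | i. i \<le> n}"

definition supported :: "nat \<Rightarrow> nat set set \<Rightarrow> (nat \<Rightarrow> nat) \<Rightarrow> bool" where
  "supported n F \<pi> \<longleftrightarrow> prefix_sets n \<pi> \<subseteq> F"

text \<open>A chain \<open>S\<^sub>0 \<subset> \<dots> \<subset> S\<^sub>n\<close> is encoded as the list \<open>[S\<^sub>0, \<dots>, S\<^sub>n]\<close>.\<close>

definition num_chains :: "nat \<Rightarrow> nat set set \<Rightarrow> nat" where
  "num_chains n F = card {Ss. length Ss = n + 1 \<and> set Ss \<subseteq> F \<and> sorted_wrt (\<subset>) Ss}"

definition S_val :: "nat \<Rightarrow> nat set set \<Rightarrow> real" where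
  "S_val n F = real (card F) powr (1 / real n)"

definition P_val :: "nat \<Rightarrow> nat set set \<Rightarrow> ereal" where
  "P_val n F = (if num_chains n F = 0 then \<infinity>
     else ereal ((fact n / real (num_chains n F)) powr (1 / real n)))"

text \<open>The binary logarithm on extended reals, so that an infinite \<open>P_val\<close> violates every
  real upper bound.\<close>

definition elg :: "ereal \<Rightarrow> ereal" where
  "elg x = (if x = \<infinity> then \<infinity> else if x \<le> 0 then - \<infinity> else ereal (log 2 (real_of_ereal x)))"

definition regularly_intersecting :: "nat \<Rightarrow> nat set set \<Rightarrow> nat set set \<Rightarrow> bool" where
  "regularly_intersecting n F\<^sub>1 F\<^sub>2 \<longleftrightarrow>
     (\<exists>G. G \<subseteq> F\<^sub>1 \<inter> F\<^sub>2 \<and>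
        (\<forall>\<pi>. \<pi> permutes {1..n} \<and> supported n F\<^sub>1 \<pi> \<and> supported n F\<^sub>2 \<pi>
             \<longrightarrow> prefix_sets n \<pi> \<inter> G \<noteq> {}) \<and>
        (\<forall>\<pi>. \<pi> permutes {1..n} \<and> supported n F\<^sub>1 \<pi> \<and> \<not> supported n F\<^sub>2 \<pi>
             \<longrightarrow> prefix_sets n \<pi> \<inter> G = {}))"

definition regularly_self_intersecting :: "nat \<Rightarrow> nat set set \<Rightarrow> bool" where
  "regularly_self_intersecting n F \<longleftrightarrow>
     (\<forall>F'. isomorphic_systems n F F' \<longrightarrow> regularly_intersecting n F F')"

end

theory Submission
  imports Defs "HOL-Real_Asymp.Real_Asymp"
begin

text \<open>
  Fix \<open>A \<subseteq> [n]\<close> with \<open>a \<approx> \<alpha>n\<close> elements and \<open>b \<approx> \<beta>n\<close>, and let the family consist of all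
  subsets of \<open>A\<close> together with all sets that meet \<open>A\<close> in at least \<open>b\<close> points. A permutation is
  supported iff its first \<open>b\<close> entries lie in \<open>A\<close>, so for the relabeled family given by \<open>A'\<close> the
  \<open>b\<close>-subsets of \<open>A \<inter> A'\<close> witness regular intersection. The family has at most
  \<open>2^a + 2^(n-a) * (\<Sum>k\<ge>b. a choose k)\<close> members, and a random permutation is supported with
  probability \<open>(a choose b) / (n choose b)\<close>. The binomial coefficients are estimated through the
  binomial distributions with parameters \<open>\<beta>/\<alpha>\<close> and \<open>\<beta>\<close>; \<open>b\<close> is chosen to be a mode of the first
  one, which yields the lower bound on \<open>a choose b\<close> without Stirling's formula.
\<close>

section \<open>Binomial point probabilities: tail bound and mode\<close>

definition binomial_prob :: "nat \<Rightarrow> real \<Rightarrow> nat \<Rightarrow> real" where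
  "binomial_prob m p k = real (m choose k) * (p ^ k * (1 - p) ^ (m - k))"

lemma sum_binomial_prob: "(\<Sum>k\<le>m. binomial_prob m p k) = 1"
  using binomial_ring[of p "1 - p" m] by (simp add: binomial_prob_def mult.assoc)

lemma binomial_prob_nonneg: "0 \<le> p \<Longrightarrow> p \<le> 1 \<Longrightarrow> 0 \<le> binomial_prob m p k"
  by (simp add: binomial_prob_def)

lemma binomial_prob_le_1:
  assumes "0 \<le> p" "p \<le> 1" "k \<le> m"
  shows "binomial_prob m p k \<le> 1"
  using member_le_sum[of k "{..m}" "binomial_prob m p"] binomial_prob_nonneg assms sum_binomial_prob[of m p] by simp

text \<open>For \<open>p \<ge> 1/2\<close>, turning \<open>d\<close> failures into successes does
  not lower a Bernoulli weight. Hence the weight at \<open>b\<close> is at most the weight at every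
  \<open>k \<ge> b\<close>, and the probabilities from \<open>b\<close> on sum to at most 1. This is
  where \<open>\<alpha> / 2 \<le> \<beta>\<close> enters the theorem.\<close>

lemma binomial_tail_le:
  assumes p: "1 / 2 \<le> p" "p \<le> 1" and "b \<le> a"
  shows "(\<Sum>k=b..a. real (a choose k)) * (p ^ b * (1 - p) ^ (a - b)) \<le> 1"
proof -
  have "real (a choose k) * (p ^ b * (1 - p) ^ (a - b)) \<le> binomial_prob a p k" if k: "k \<in> {b..a}" for k
  proof -
    obtain d where d: "k = b + d" using k le_Suc_ex by auto
    have "(1 - p) ^ (a - b) = (1 - p) ^ (a - k) * (1 - p) ^ d"
      using k d by (simp flip: power_add)
    moreover have "(1 - p) ^ d \<le> p ^ d"
      using p by (intro power_mono) auto
    ultimately have "p ^ b * (1 - p) ^ (a - b) \<le> p ^ b * ((1 - p) ^ (a - k) * p ^ d)"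
      using p by (simp add: mult_left_mono)
    also have "\<dots> = p ^ k * (1 - p) ^ (a - k)"
      by (simp add: d power_add)
    finally show ?thesis
      by (simp add: binomial_prob_def mult_left_mono)
  qed
  then have "(\<Sum>k=b..a. real (a choose k)) * (p ^ b * (1 - p) ^ (a - b)) \<le> (\<Sum>k=b..a. binomial_prob a p k)"
    unfolding sum_distrib_right by (rule sum_mono)
  also have "\<dots> \<le> (\<Sum>k\<le>a. binomial_prob a p k)"
    using p by (intro sum_mono2) (auto intro: binomial_prob_nonneg)
  finally show ?thesis by (simp add: sum_binomial_prob)
qed

text \<open>Here and in \<open>binomial_prob_pred\<close>, neighbouring probabilities get a common
  factor with exponent \<open>m - Suc k\<close>, so that they can be compared without dividing by
  \<open>p\<close> or \<open>1 - p\<close>, either of which may be 0.\<close>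

lemma binomial_prob_Suc:
  assumes "k < m"
  shows "real (Suc k) * binomial_prob m p (Suc k)
    = real (m - k) * p * (real (m choose k) * (p ^ k * (1 - p) ^ (m - Suc k)))"
proof -
  have "real (Suc k) * real (m choose Suc k) = real (m - k) * real (m choose k)"
    by (metis binomial_absorb_comp binomial_absorption mult.commute of_nat_mult)
  then show ?thesis
    by (simp add: binomial_prob_def)
qed

lemma binomial_prob_pred:
  assumes "k < m"
  shows "binomial_prob m p k = (1 - p) * (real (m choose k) * (p ^ k * (1 - p) ^ (m - Suc k)))"
proof -
  have "(1 - p) ^ (m - k) = (1 - p) * (1 - p) ^ (m - Suc k)"
    using assms by (metis Suc_diff_Suc power_Suc)
  then show ?thesis by (simp add: binomial_prob_def)
qed

lemma binomial_prob_le_Suc: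
  assumes p: "0 \<le> p" "p \<le> 1" and k: "k < m" and le: "real (Suc k) \<le> (real m + 1) * p"
  shows "binomial_prob m p k \<le> binomial_prob m p (Suc k)"
proof -
  let ?c = "real (m choose k) * (p ^ k * (1 - p) ^ (m - Suc k))"
  \<comment> \<open>Expanded, this is exactly the hypothesis \<open>le\<close>: the products with
    \<open>p * k\<close> cancel.\<close>
  have "real (Suc k) * (1 - p) \<le> real (m - k) * p"
    using le k by (simp add: of_nat_diff algebra_simps)
  then have "real (Suc k) * (1 - p) * ?c \<le> real (m - k) * p * ?c"
    using p by (intro mult_right_mono) auto
  then have "real (Suc k) * binomial_prob m p k \<le> real (Suc k) * binomial_prob m p (Suc k)"
    unfolding binomial_prob_Suc[OF k] binomial_prob_pred[OF k] by (simp add: mult.assoc)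
  then show ?thesis by (subst (asm) mult_le_cancel_left_pos) auto
qed

lemma binomial_prob_Suc_le:
  assumes p: "0 \<le> p" "p \<le> 1" and k: "k < m" and le: "(real m + 1) * p \<le> real (Suc k)"
  shows "binomial_prob m p (Suc k) \<le> binomial_prob m p k"
proof -
  let ?c = "real (m choose k) * (p ^ k * (1 - p) ^ (m - Suc k))"
  have "real (m - k) * p \<le> real (Suc k) * (1 - p)"
    using le k by (simp add: of_nat_diff algebra_simps)
  then have "real (m - k) * p * ?c \<le> real (Suc k) * (1 - p) * ?c"
    using p by (intro mult_right_mono) auto
  then have "real (Suc k) * binomial_prob m p (Suc k) \<le> real (Suc k) * binomial_prob m p k"
    unfolding binomial_prob_Suc[OF k] binomial_prob_pred[OF k] by (simp add: mult.assoc)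
  then show ?thesis by (subst (asm) mult_le_cancel_left_pos) auto
qed

text \<open>The probabilities rise as long as the next index is at most \<open>(m + 1) * p\<close>
  and fall from there on. The bounds \<open>lo\<close> and \<open>hi\<close> place \<open>b\<close>
  at the turning point, so single steps from \<open>k\<close> towards \<open>b\<close> never
  decrease the value.\<close>

lemma binomial_prob_mode:
  assumes p: "0 \<le> p" "p \<le> 1" and "b \<le> m"
    and lo: "(real m + 1) * p - 1 \<le> real b" and hi: "real b \<le> (real m + 1) * p"
    and "k \<le> m"
  shows "binomial_prob m p k \<le> binomial_prob m p b"
proof (cases "k \<le> b")
  case True
  then show ?thesis
  proof (induction rule: inc_induct)
    case (step j)
    then show ?case
      using binomial_prob_le_Suc[of p j m] p hi \<open>b \<le> m\<close> by force
  qed simp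
next
  case False
  then have "b \<le> k" by simp
  then show ?thesis using \<open>k \<le> m\<close>
  proof (induction k rule: dec_induct)
    case (step j)
    then show ?case
      using binomial_prob_Suc_le[of p j m] p lo by force
  qed simp
qed

text \<open>The \<open>m + 1\<close> probabilities sum to 1, so the largest of them is at least
  their average.\<close>

lemma one_le_binomial_prob_mode:
  assumes "0 \<le> p" "p \<le> 1" "b \<le> m"
    and "(real m + 1) * p - 1 \<le> real b" and "real b \<le> (real m + 1) * p"
  shows "1 \<le> (real m + 1) * binomial_prob m p b"
  using sum_bounded_above[of "{..m}" "binomial_prob m p" "binomial_prob m p b"] binomial_prob_mode[OF assms] sum_binomial_prob[of m p]
  by (simp add: add.commute)

section \<open>Entropy and logarithms of Bernoulli weights\<close>

lemma bin_entropy_eq: "bin_entropy x = - x * log 2 x - (1 - x) * log 2 (1 - x)"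
  \<comment> \<open>At the endpoints, \<open>log 2 0\<close> occurs only with coefficient 0, so the
    case distinction disappears.\<close>
  by (auto simp: bin_entropy_def log_def)

text \<open>The last assumption keeps the weight positive at \<open>p = 1\<close>: the factor
  \<open>1 - p = 0\<close> then has exponent 0, and \<open>log 2 0\<close> has coefficient 0 on the
  right.\<close>

lemma log_bernoulli_weight:
  assumes "0 < p" "p \<le> 1" "k \<le> m" "p = 1 \<Longrightarrow> k = m"
  shows "log 2 (p ^ k * (1 - p) ^ (m - k)) = real k * log 2 p + (real m - real k) * log 2 (1 - p)"
    and "0 < p ^ k * (1 - p) ^ (m - k)"
  using assms by (cases "p = 1"; simp add: log_mult log_nat_power of_nat_diff)+

lemma log_binomial_prob:
  assumes "0 < p" "p \<le> 1" "k \<le> m" "p = 1 \<Longrightarrow> k = m"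
  shows "log 2 (binomial_prob m p k)
      = log 2 (real (m choose k)) + (real k * log 2 p + (real m - real k) * log 2 (1 - p))"
    and "0 < binomial_prob m p k"
proof -
  have c: "0 < real (m choose k)" using assms by simp
  have w: "log 2 (p ^ k * (1 - p) ^ (m - k)) = real k * log 2 p + (real m - real k) * log 2 (1 - p)"
    "0 < p ^ k * (1 - p) ^ (m - k)"
    using log_bernoulli_weight[of p k m] assms by blast+
  show "log 2 (binomial_prob m p k)
      = log 2 (real (m choose k)) + (real k * log 2 p + (real m - real k) * log 2 (1 - p))"
    unfolding binomial_prob_def w(1)[symmetric] using c w(2) by (rule log_mult_pos)
  show "0 < binomial_prob m p k"
    unfolding binomial_prob_def using c w(2) by (rule mult_pos_pos)
qed

section \<open>The front system: supported permutations and regular intersection\<close>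

definition front_system :: "nat \<Rightarrow> nat set \<Rightarrow> nat \<Rightarrow> nat set set" where
  "front_system n A b = {X. X \<subseteq> {1..n} \<and> (X \<subseteq> A \<or> b \<le> card (X \<inter> A))}"

text \<open>On sets of size \<open>b\<close> the two alternatives in \<open>front_system\<close>
  agree, since such a set with \<open>b\<close> points in \<open>A\<close> lies in \<open>A\<close>.
  Conversely, prefix-sets shorter than \<open>b\<close> inherit the inclusion in \<open>A\<close>,
  and longer ones contain these \<open>b\<close> points of \<open>A\<close>.\<close>

lemma supported_front_system_iff:
  assumes \<pi>: "\<pi> permutes {1..n}" and "b \<le> n"
  shows "supported n (front_system n A b) \<pi> \<longleftrightarrow> \<pi> ` {1..b} \<subseteq> A"
proof -
  have card: "card (\<pi> ` {1..i}) = i" for i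
    using permutes_inj_on[OF \<pi>] by (simp add: card_image)
  have sub: "\<pi> ` {1..i} \<subseteq> {1..n}" if "i \<le> n" for i
    using that permutes_image[OF \<pi>] by (metis atLeastatMost_subset_iff image_mono order_refl)
  show ?thesis
  proof
    assume "supported n (front_system n A b) \<pi>"
    then have "\<pi> ` {1..b} \<in> front_system n A b"
      using \<open>b \<le> n\<close> by (auto simp: supported_def prefix_sets_def)
    moreover have "\<pi> ` {1..b} \<subseteq> A" if "b \<le> card (\<pi> ` {1..b} \<inter> A)"
      using that card[of b] by (metis card_seteq finite_atLeastAtMost finite_imageI inf.orderI inf_commute inf_le1)
    ultimately show "\<pi> ` {1..b} \<subseteq> A" by (auto simp: front_system_def)
  next
    assume A: "\<pi> ` {1..b} \<subseteq> A"
    have "\<pi> ` {1..i} \<in> front_system n A b" if "i \<le> n" for i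
    proof (cases "i \<le> b")
      case True
      then have "\<pi> ` {1..i} \<subseteq> A" using A by (meson atLeastatMost_subset_iff image_mono order_refl subset_trans)
      then show ?thesis using sub[OF that] by (simp add: front_system_def)
    next
      case False
      then have "\<pi> ` {1..b} \<subseteq> \<pi> ` {1..i} \<inter> A" using A by auto
      then have "b \<le> card (\<pi> ` {1..i} \<inter> A)" using card[of b] card_mono
        by (metis finite_Int finite_atLeastAtMost finite_imageI)
      then show ?thesis using sub[OF that] by (simp add: front_system_def)
    qed
    then show "supported n (front_system n A b) \<pi>"
      by (auto simp: supported_def prefix_sets_def)
  qed
qed

lemma image_front_system:
  assumes \<sigma>: "\<sigma> permutes {1..n}"
  shows "(\<lambda>X. \<sigma> ` X) ` front_system n A b = front_system n (\<sigma> ` A) b"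
proof -
  \<comment> \<open>Stated for an arbitrary permutation, to be applied to \<open>\<sigma>\<close>
    for one inclusion and to its inverse for the other.\<close>
  have one: "\<rho> ` X \<in> front_system n (\<rho> ` B) b"
    if "\<rho> permutes {1..n}" "X \<in> front_system n B b" for \<rho> X B
  proof -
    have inj: "inj \<rho>" using that(1) by (rule permutes_inj)
    have "\<rho> ` X \<subseteq> {1..n}"
      using that permutes_image[OF that(1)] by (metis (no_types, lifting) front_system_def image_mono mem_Collect_eq)
    moreover have "card (\<rho> ` X \<inter> \<rho> ` B) = card (X \<inter> B)"
      using inj by (metis card_image image_Int inj_on_subset subset_UNIV)
    ultimately show ?thesis using that(2) by (auto simp: front_system_def)
  qed
  show ?thesis
  proof
    show "(\<lambda>X. \<sigma> ` X) ` front_system n A b \<subseteq> front_system n (\<sigma> ` A) b"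
      using one[OF \<sigma>] by auto
    show "front_system n (\<sigma> ` A) b \<subseteq> (\<lambda>X. \<sigma> ` X) ` front_system n A b"
    proof
      fix Y assume "Y \<in> front_system n (\<sigma> ` A) b"
      from one[OF permutes_inv[OF \<sigma>] this]
      have "inv \<sigma> ` Y \<in> front_system n A b"
        using permutes_inj[OF \<sigma>] by (simp add: image_comp)
      moreover have "Y = \<sigma> ` (inv \<sigma> ` Y)"
        using permutes_surj[OF \<sigma>] by (simp add: image_f_inv_f)
      ultimately show "Y \<in> (\<lambda>X. \<sigma> ` X) ` front_system n A b" by blast
    qed
  qed
qed

text \<open>A permutation has exactly one prefix-set of size \<open>b\<close>, so it meets the
  witness iff that set lies in both \<open>A\<close> and \<open>B\<close>, that is, iff both systems
  support it. As \<open>A\<close> and \<open>B\<close> are arbitrary here, the witness is confined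
  to the ground set explicitly.\<close>

lemma regularly_intersecting_front_systems:
  assumes "b \<le> n"
  shows "regularly_intersecting n (front_system n A b) (front_system n B b)"
  unfolding regularly_intersecting_def
proof (intro exI conjI allI impI)
  let ?G = "{X. X \<subseteq> {1..n} \<and> X \<subseteq> A \<inter> B \<and> card X = b}"
  show "?G \<subseteq> front_system n A b \<inter> front_system n B b"
    by (auto simp: front_system_def)
  fix \<pi>
  {
    assume "\<pi> permutes {1..n} \<and> supported n (front_system n A b) \<pi> \<and> supported n (front_system n B b) \<pi>"
    then have \<pi>: "\<pi> permutes {1..n}" and "\<pi> ` {1..b} \<subseteq> A \<inter> B"
      using supported_front_system_iff[OF _ assms] by (auto simp del: One_nat_def)
    moreover have "card (\<pi> ` {1..b}) = b"
      using permutes_inj_on[OF \<pi>] by (simp add: card_image)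
    moreover have "\<pi> ` {1..b} \<subseteq> {1..n}"
      using assms permutes_image[OF \<pi>] by (metis atLeastatMost_subset_iff image_mono order_refl)
    ultimately have "\<pi> ` {1..b} \<in> prefix_sets n \<pi> \<inter> ?G"
      using assms by (auto simp: prefix_sets_def)
    then show "prefix_sets n \<pi> \<inter> ?G \<noteq> {}" by blast
  }
  {
    assume "\<pi> permutes {1..n} \<and> supported n (front_system n A b) \<pi> \<and> \<not> supported n (front_system n B b) \<pi>"
    then have \<pi>: "\<pi> permutes {1..n}" and nB: "\<not> \<pi> ` {1..b} \<subseteq> B"
      using supported_front_system_iff[OF _ assms] by (auto simp del: One_nat_def)
    have "card (\<pi> ` {1..i}) = i" for i
      using permutes_inj_on[OF \<pi>] by (simp add: card_image)
    then show "prefix_sets n \<pi> \<inter> ?G = {}"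
      using nB by (force simp: prefix_sets_def simp del: One_nat_def)
  }
qed

lemma regularly_self_intersecting_front_system:
  "b \<le> n \<Longrightarrow> regularly_self_intersecting n (front_system n A b)"
  by (auto simp: regularly_self_intersecting_def isomorphic_systems_def image_front_system
      regularly_intersecting_front_systems)

section \<open>Counting members and chains\<close>

lemma card_large_subsets:
  assumes "finite A"
  shows "card {Y. Y \<subseteq> A \<and> b \<le> card Y} = (\<Sum>k=b..card A. card A choose k)"
proof -
  have "{Y. Y \<subseteq> A \<and> b \<le> card Y} = (\<Union>k\<in>{b..card A}. {Y. Y \<subseteq> A \<and> card Y = k})"
    using assms by (auto intro: card_mono)
  also have "card \<dots> = (\<Sum>k=b..card A. card {Y. Y \<subseteq> A \<and> card Y = k})"
    by (rule card_UN_disjoint) (use assms in auto)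
  finally show ?thesis using assms by (simp add: n_subsets)
qed

text \<open>A member that is not a subset of \<open>A\<close> is determined by its part outside
  \<open>A\<close>, which is free, and its part inside \<open>A\<close>, which has at least
  \<open>b\<close> points.\<close>

lemma card_front_system_le:
  assumes A: "A \<subseteq> {1..n}"
  shows "card (front_system n A b)
    \<le> 2 ^ card A + 2 ^ (n - card A) * (\<Sum>k=b..card A. card A choose k)"
proof -
  have fin: "finite A" using A finite_subset by blast
  let ?L = "{X. X \<subseteq> {1..n} \<and> b \<le> card (X \<inter> A)}"
  let ?T = "Pow ({1..n} - A) \<times> {Y. Y \<subseteq> A \<and> b \<le> card Y}"
  have "front_system n A b \<subseteq> Pow A \<union> ?L" by (auto simp: front_system_def)
  then have "card (front_system n A b) \<le> card (Pow A \<union> ?L)"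
    using fin by (intro card_mono) auto
  also have "\<dots> \<le> card (Pow A) + card ?L" by (rule card_Un_le)
  also have "card ?L \<le> card ?T"
  proof (rule card_inj_on_le)
    show "inj_on (\<lambda>X. (X - A, X \<inter> A)) ?L" by (rule inj_onI) blast
    show "(\<lambda>X. (X - A, X \<inter> A)) ` ?L \<subseteq> ?T" by auto
    show "finite ?T" using fin by simp
  qed
  also have "card ?T = 2 ^ (n - card A) * (\<Sum>k=b..card A. card A choose k)"
    using A fin by (simp add: card_cartesian_product card_Pow card_Diff_subset card_large_subsets)
  finally show ?thesis using fin by (simp add: card_Pow)
qed

text \<open>An enumeration splits uniquely into an arrangement of \<open>b\<close> elements of
  \<open>A\<close> and an arrangement of the remaining \<open>n - b\<close> elements of the ground
  set. The factor \<open>fact (card A - b)\<close> clears the denominator of the falling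
  factorial.\<close>

lemma card_front_enumerations:
  assumes A: "A \<subseteq> {1..n}" and b: "b \<le> card A"
  shows "card {zs. distinct zs \<and> set zs = {1..n} \<and> set (take b zs) \<subseteq> A} * fact (card A - b)
    = fact (card A) * fact (n - b)"
proof -
  have fin: "finite A" using A finite_subset by blast
  have cA: "card A \<le> n" using card_mono[OF _ A] by simp
  let ?X = "{xs. length xs = b \<and> distinct xs \<and> set xs \<subseteq> A}"
  let ?Y = "\<lambda>xs. {ys. length ys = n - b \<and> distinct ys \<and> set ys \<subseteq> {1..n} - set xs}"
  let ?Z = "{zs. distinct zs \<and> set zs = {1..n} \<and> set (take b zs) \<subseteq> A}"
  have len: "length zs = n" if "distinct zs" "set zs = {1..n}" for zs
    using that distinct_card by fastforce
  have "bij_betw (\<lambda>(xs, ys). xs @ ys) (Sigma ?X ?Y) ?Z"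
  proof (rule bij_betwI[where g = "\<lambda>zs. (take b zs, drop b zs)"])
    show "(\<lambda>(xs, ys). xs @ ys) \<in> Sigma ?X ?Y \<rightarrow> ?Z"
    proof (rule funcsetI)
      fix z assume "z \<in> Sigma ?X ?Y"
      then obtain xs ys where z: "z = (xs, ys)"
        and xs: "distinct xs" "set xs \<subseteq> A" "b = length xs"
        and ys: "length ys = n - length xs" "distinct ys" "set ys \<subseteq> {1..n} - set xs"
        by auto
      have d: "distinct (xs @ ys)" using xs ys by auto
      have "card (set (xs @ ys)) = card {1..n}"
        using distinct_card[OF d] ys xs b cA by simp
      moreover have "set (xs @ ys) \<subseteq> {1..n}" using xs ys A by auto
      ultimately have "set (xs @ ys) = {1..n}" by (intro card_subset_eq) auto
      then show "(case z of (xs, ys) \<Rightarrow> xs @ ys) \<in> ?Z"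
        using d xs z by simp
    qed
    show "(\<lambda>zs. (take b zs, drop b zs)) \<in> ?Z \<rightarrow> Sigma ?X ?Y"
    proof (rule funcsetI)
      fix zs assume "zs \<in> ?Z"
      then have zs: "distinct zs" "set zs = {1..n}" "set (take b zs) \<subseteq> A" by auto
      have "set (take b zs) \<inter> set (drop b zs) = {}"
        using zs(1) by (simp add: set_take_disj_set_drop_if_distinct)
      then show "(take b zs, drop b zs) \<in> Sigma ?X ?Y"
        using zs len[OF zs(1,2)] b cA set_drop_subset[of b zs] by auto
    qed
  qed auto
  then have "card ?Z = card (Sigma ?X ?Y)" by (rule bij_betw_same_card[symmetric])
  also have "\<dots> = (\<Sum>xs\<in>?X. card (?Y xs))"
  proof (rule card_SigmaI)
    show "finite ?X"
      using finite_lists_length_eq[OF fin, of b] by (rule rev_finite_subset) auto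
    show "\<forall>xs\<in>?X. finite (?Y xs)"
    proof
      fix xs
      show "finite (?Y xs)"
        using finite_lists_length_eq[of "{1..n}" "n - b"] by (rule rev_finite_subset) auto
    qed
  qed
  also have "\<dots> = (\<Sum>xs\<in>?X. fact (n - b))"
  proof (rule sum.cong)
    fix xs assume "xs \<in> ?X"
    then have "card ({1..n} - set xs) = n - b"
      using A distinct_card[of xs] by (subst card_Diff_subset) auto
    then show "card (?Y xs) = fact (n - b)"
      using card_lists_distinct_length_eq[of "{1..n} - set xs" "n - b"] by (simp add: fact_prod)
  qed simp
  also have "\<dots> = card ?X * fact (n - b)" by simp
  also have "card ?X = fact (card A) div fact (card A - b)"
    using card_lists_distinct_length_eq[OF fin b] b by (simp add: fact_div_fact)
  finally show ?thesis
    using b by (simp add: fact_dvd mult.commute mult.left_commute)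
qed

text \<open>Each enumeration yields the chain of its prefix-sets and can be recovered from it,
  because each entry is the only new element at its step. A lower bound on the number of chains
  suffices, as it bounds \<open>P_val\<close> from above.\<close>

lemma num_chains_front_system_ge:
  assumes A: "A \<subseteq> {1..n}" and b: "b \<le> n"
  shows "card {zs. distinct zs \<and> set zs = {1..n} \<and> set (take b zs) \<subseteq> A}
    \<le> num_chains n (front_system n A b)"
  unfolding num_chains_def
proof (rule card_inj_on_le)
  let ?Z = "{zs. distinct zs \<and> set zs = {1..n} \<and> set (take b zs) \<subseteq> A}"
  let ?f = "\<lambda>zs. map (\<lambda>i. set (take i zs)) [0..<Suc n]"
  let ?C = "{Ss. length Ss = n + 1 \<and> set Ss \<subseteq> front_system n A b \<and> sorted_wrt (\<subset>) Ss}"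
  have len: "length zs = n" if "zs \<in> ?Z" for zs
    using that distinct_card by fastforce
  have step: "set (take (Suc i) zs) = insert (zs ! i) (set (take i zs))" "zs ! i \<notin> set (take i zs)"
    if "zs \<in> ?Z" "i < n" for zs i
  proof -
    show "set (take (Suc i) zs) = insert (zs ! i) (set (take i zs))"
      using len[OF that(1)] that(2) by (simp add: take_Suc_conv_app_nth)
    have "distinct (take (Suc i) zs)" using that by simp
    then show "zs ! i \<notin> set (take i zs)"
      using len[OF that(1)] that(2) by (simp add: take_Suc_conv_app_nth)
  qed
  show "inj_on ?f ?Z"
  proof (rule inj_onI)
    fix xs ys assume xs: "xs \<in> ?Z" and ys: "ys \<in> ?Z" and eq: "?f xs = ?f ys"
    have e: "set (take i xs) = set (take i ys)" if "i \<le> n" for i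
      using eq that by (auto simp: map_eq_conv simp del: upt_Suc)
    show "xs = ys"
    proof (rule nth_equalityI)
      show "length xs = length ys" using len[OF xs] len[OF ys] by simp
      fix i assume "i < length xs"
      then have i: "i < n" using len[OF xs] by simp
      show "xs ! i = ys ! i"
        using step[OF xs i] step[OF ys i] e[of i] e[of "Suc i"] i by auto
    qed
  qed
  show "?f ` ?Z \<subseteq> ?C"
  proof
    fix Ss assume "Ss \<in> ?f ` ?Z"
    then obtain zs where zs: "zs \<in> ?Z" and Ss: "Ss = ?f zs" by blast
    have "set (take i zs) \<in> front_system n A b" if "i \<le> n" for i
    proof (cases "i \<le> b")
      case True
      then have "set (take i zs) \<subseteq> A" using zs set_take_subset_set_take[of i b zs] by auto
      then show ?thesis using A by (auto simp: front_system_def)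
    next
      case False
      then have "set (take b zs) \<subseteq> set (take i zs) \<inter> A"
        using zs set_take_subset_set_take[of b i zs] by auto
      then have "card (set (take b zs)) \<le> card (set (take i zs) \<inter> A)"
        by (intro card_mono) auto
      moreover have "card (set (take b zs)) = b"
        using zs len[OF zs] b by (simp add: distinct_card)
      moreover have "set (take i zs) \<subseteq> {1..n}" using zs set_take_subset by fastforce
      ultimately show ?thesis by (simp add: front_system_def)
    qed
    moreover have "set (take i zs) \<subset> set (take j zs)" if "i < j" "j \<le> n" for i j
    proof -
      have "set (take i zs) \<subset> set (take (Suc i) zs)"
        using step[OF zs, of i] that by auto
      also have "\<dots> \<subseteq> set (take j zs)" using that by (intro set_take_subset_set_take) simp
      finally show ?thesis .
    qed
    ultimately show "Ss \<in> ?C"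
      unfolding Ss by (auto simp: sorted_wrt_iff_nth_less simp del: upt_Suc)
  qed
  have "finite (front_system n A b)"
    by (rule finite_subset[of _ "Pow {1..n}"]) (auto simp: front_system_def)
  from finite_lists_length_eq[OF this, of "n + 1"] show "finite ?C"
    by (rule rev_finite_subset) auto
qed

text \<open>The bound is the reciprocal of the probability that the first \<open>b\<close> entries
  of a random permutation lie in \<open>A\<close>.\<close>

lemma fact_div_num_chains_front_system:
  assumes A: "A \<subseteq> {1..n}" and b: "b \<le> card A"
  shows "0 < num_chains n (front_system n A b)"
    and "fact n / real (num_chains n (front_system n A b)) \<le> real (n choose b) / real (card A choose b)"
proof -
  have cA: "card A \<le> n" using card_mono[OF _ A] by simp
  let ?z = "card {zs. distinct zs \<and> set zs = {1..n} \<and> set (take b zs) \<subseteq> A}"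
  have z: "real ?z * fact (card A - b) = fact (card A) * fact (n - b)"
    using arg_cong[OF card_front_enumerations[OF A b], of real] by simp
  have le: "?z \<le> num_chains n (front_system n A b)"
    using num_chains_front_system_ge[OF A] b cA by simp
  have pos: "0 < ?z" using z by (intro Nat.gr0I) simp
  then show "0 < num_chains n (front_system n A b)" using le by simp
  have "fact n / real (num_chains n (front_system n A b)) \<le> fact n / real ?z"
    using le pos by (intro divide_left_mono) auto
  also have "real ?z = fact (card A) * fact (n - b) / fact (card A - b)"
    using z by (simp add: field_simps)
  also have "fact n / \<dots> = real (n choose b) / real (card A choose b)"
    using b cA by (simp add: binomial_fact field_simps)
  finally show "fact n / real (num_chains n (front_system n A b)) \<le> real (n choose b) / real (card A choose b)" .
qed

section \<open>Logarithmic bounds and the entropy identity\<close>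

lemma elg_P_val:
  assumes "0 < num_chains n F"
  shows "elg (P_val n F) = ereal (log 2 (fact n / real (num_chains n F)) / real n)"
  using assms by (simp add: elg_def P_val_def log_powr)

lemma log_S_val: "F \<noteq> {} \<Longrightarrow> finite F \<Longrightarrow> log 2 (S_val n F) = log 2 (real (card F)) / real n"
  by (simp add: S_val_def log_powr)

text \<open>The limiting form of the identity
  \<open>(n choose b) / (a choose b) = (n choose a) / ((n - b) choose (a - b))\<close>.\<close>

lemma bin_entropy_exchange:
  assumes "0 < \<beta>" "\<beta> \<le> \<alpha>" "\<alpha> \<le> 1"
  shows "bin_entropy \<beta> - \<alpha> * bin_entropy (\<beta> / \<alpha>)
    = bin_entropy \<alpha> - (1 - \<beta>) * bin_entropy ((\<alpha> - \<beta>) / (1 - \<beta>))"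
proof (cases "\<beta> = 1")
  case True
  \<comment> \<open>Here \<open>\<alpha> = 1\<close> as well, and the entropy with the undefined
    quotient is multiplied by \<open>1 - \<beta> = 0\<close>.\<close>
  then show ?thesis using assms by (simp add: bin_entropy_def)
next
  case False
  \<comment> \<open>Scaling an entropy turns it into terms \<open>u * log 2 u\<close>. After
    cancellation both sides of the claim consist of such terms for \<open>\<alpha>\<close>,
    \<open>1 - \<beta>\<close> and \<open>\<alpha> - \<beta>\<close> only.\<close>
  have split: "y * bin_entropy (x / y)
      = y * log 2 y - x * log 2 x - (y - x) * log 2 (y - x)"
    if "0 \<le> x" "x \<le> y" "0 < y" for x y :: real
  proof -
    have "y * bin_entropy (x / y) = - (x * log 2 (x / y)) - (y - x) * log 2 ((y - x) / y)"
    proof -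
      have "1 - x / y = (y - x) / y" using that by (simp add: field_simps)
      then show ?thesis using that by (simp add: bin_entropy_eq right_diff_distrib)
    qed
    moreover have "x * log 2 (x / y) = x * (log 2 x - log 2 y)"
      using that by (cases "x = 0") (auto simp: log_divide)
    moreover have "(y - x) * log 2 ((y - x) / y) = (y - x) * (log 2 (y - x) - log 2 y)"
      using that by (cases "x = y") (auto simp: log_divide)
    ultimately show ?thesis
      by (simp add: algebra_simps)
  qed
  show ?thesis
    using assms False split[of \<beta> \<alpha>] split[of "\<alpha> - \<beta>" "1 - \<beta>"]
    by (simp add: bin_entropy_eq algebra_simps)
qed

text \<open>\<open>L\<close> is the logarithm of the Bernoulli weight at \<open>b\<close>, so the
  tail of binomial coefficients is at most \<open>2 powr (- L)\<close>. The count is then bounded by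
  a sum of two powers of 2, hence by twice the larger one, which explains the summand 1.\<close>

lemma log_card_front_system_le:
  assumes A: "A \<subseteq> {1..n}" and b: "b \<le> card A" and p: "1 / 2 \<le> p" "p \<le> 1" "p = 1 \<Longrightarrow> b = card A"
  defines "L \<equiv> real b * log 2 p + (real (card A) - real b) * log 2 (1 - p)"
  shows "log 2 (real (card (front_system n A b)))
    \<le> 1 + max (real (card A)) (real n - real (card A) - L)"
proof -
  let ?a = "card A" and ?w = "p ^ b * (1 - p) ^ (card A - b)"
  have cA: "?a \<le> n" using card_mono[OF _ A] by simp
  have w: "0 < ?w" "log 2 ?w = L"
    using log_bernoulli_weight[of p b ?a] p b unfolding L_def by auto
  have tail: "(\<Sum>k=b..?a. real (?a choose k)) \<le> 1 / ?w"
    using binomial_tail_le[OF p(1,2) b] w(1) by (simp add: pos_le_divide_eq)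
  have w': "1 / ?w = 2 powr (- L)"
  proof -
    have "?w = 2 powr L" using powr_log_cancel[of 2 ?w] w by simp
    then show ?thesis by (simp only: powr_minus_divide)
  qed
  have "real (card (front_system n A b)) \<le> 2 ^ ?a + 2 ^ (n - ?a) * (\<Sum>k=b..?a. real (?a choose k))"
    using card_front_system_le[OF A, of b] of_nat_mono by fastforce
  also have "\<dots> \<le> 2 ^ ?a + 2 ^ (n - ?a) * (1 / ?w)"
    using tail by (intro add_left_mono mult_left_mono) auto
  also have "\<dots> = 2 powr real ?a + 2 powr (real n - real ?a - L)"
    using cA by (simp add: w' flip: powr_realpow) (simp add: of_nat_diff flip: powr_add)
  also have "\<dots> \<le> 2 * 2 powr max (real ?a) (real n - real ?a - L)"
    by (simp add: max_def)
  also have "\<dots> = 2 powr (1 + max (real ?a) (real n - real ?a - L))"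
    by (simp add: powr_add)
  finally have *: "real (card (front_system n A b)) \<le> \<dots>" .
  \<comment> \<open>The empty set makes the cardinality positive, as needed for passing to
    logarithms.\<close>
  have "{} \<in> front_system n A b" by (simp add: front_system_def)
  moreover have "finite (front_system n A b)"
    by (rule finite_subset[of _ "Pow {1..n}"]) (auto simp: front_system_def)
  ultimately have "0 < card (front_system n A b)" by (metis card_gt_0_iff empty_iff)
  then show ?thesis using * by (simp add: log_le_iff)
qed

section \<open>Choice of parameters and passage to the limit\<close>

theorem theorem4p5:
  fixes \<epsilon> \<alpha> \<beta> :: real
  assumes "\<epsilon> > 0"
    and "0 < \<alpha>" and "\<alpha> \<le> 1"
    and "\<alpha> / 2 \<le> \<beta>" and "\<beta> \<le> \<alpha>"
  shows "\<exists>n F. n \<ge> 1 \<and> set_system n F \<and> regularly_self_intersecting n F \<and>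
    log 2 (S_val n F) \<le> max \<alpha> ((1 - \<alpha>) + \<alpha> * bin_entropy (\<beta> / \<alpha>)) + \<epsilon> \<and>
    elg (P_val n F) \<le>
      ereal (bin_entropy \<alpha> - (1 - \<beta>) * bin_entropy ((\<alpha> - \<beta>) / (1 - \<beta>)) + \<epsilon>)"
proof -
  define p where "p = \<beta> / \<alpha>"
  define a where "a n = nat \<lfloor>\<alpha> * real n\<rfloor>" for n
  \<comment> \<open>The largest integer strictly below \<open>(a n + 1) * p\<close>, hence a mode
    for the parameters \<open>a n\<close> and \<open>p\<close>. The floor would give
    \<open>a n + 1\<close> at \<open>p = 1\<close>; this choice gives
    \<open>b n = a n\<close>.\<close>
  define b where "b n = nat (\<lceil>(real (a n) + 1) * p\<rceil> - 1)" for n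
  have p: "1 / 2 \<le> p" "p \<le> 1" "0 < p"
    using assms by (auto simp: p_def field_simps)
  have \<beta>: "\<beta> = \<alpha> * p" "0 < \<beta>" "\<beta> \<le> 1" using assms by (auto simp: p_def)
  have a_hi: "real (a n) \<le> \<alpha> * real n" and a_lo: "\<alpha> * real n - 1 \<le> real (a n)" for n
    using assms by (auto simp: a_def)
  have a_le: "a n \<le> n" for n
  proof -
    have "\<alpha> * real n \<le> real n" using assms by (simp add: mult_left_le_one_le)
    then show ?thesis using a_hi[of n] by linarith
  qed
  have b_eq: "real (b n) = of_int \<lceil>(real (a n) + 1) * p\<rceil> - 1" for n
  proof -
    have "0 < (real (a n) + 1) * p" using p by (simp add: add_pos_nonneg)
    then show ?thesis by (simp add: b_def)
  qed
  have b_lo: "(real (a n) + 1) * p - 1 \<le> real (b n)" and b_hi: "real (b n) \<le> (real (a n) + 1) * p" for n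
    unfolding b_eq by linarith+
  have b_le: "b n \<le> a n" for n
  proof -
    have "(real (a n) + 1) * p \<le> real (a n) + 1" using p by (simp add: mult_left_le)
    then have "real (b n) < real (a n) + 1" unfolding b_eq by linarith
    then show ?thesis by linarith
  qed
  have b_p1: "b n = a n" if "p = 1" for n
    using that b_lo[of n] b_le[of n] by simp
  have b_\<beta>1: "b n = n" if "\<beta> = 1" for n
  proof -
    have "\<alpha> = 1" "p = 1" using that assms by (auto simp: p_def)
    then show ?thesis using b_p1[of n] by (simp add: a_def)
  qed

  have lim_a: "(\<lambda>n. real (a n) / real n) \<longlonglongrightarrow> \<alpha>"
  proof (rule tendsto_sandwich)
    show "eventually (\<lambda>n. (\<alpha> * real n - 1) / real n \<le> real (a n) / real n) sequentially"
      using a_lo by (intro always_eventually allI divide_right_mono) auto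
    show "eventually (\<lambda>n. real (a n) / real n \<le> \<alpha> * real n / real n) sequentially"
      using a_hi by (intro always_eventually allI divide_right_mono) auto
    show "(\<lambda>n. (\<alpha> * real n - 1) / real n) \<longlonglongrightarrow> \<alpha>" "(\<lambda>n. \<alpha> * real n / real n) \<longlonglongrightarrow> \<alpha>"
      by real_asymp+
  qed
  have inv0: "(\<lambda>n. 1 / real n) \<longlonglongrightarrow> 0" by real_asymp
  have lim_b: "(\<lambda>n. real (b n) / real n) \<longlonglongrightarrow> \<beta>"
  proof (rule tendsto_sandwich)
    show "eventually (\<lambda>n. (real (a n) / real n + 1 / real n) * p - 1 / real n \<le> real (b n) / real n) sequentially"
    proof (intro always_eventually allI)
      fix n
      have "((real (a n) + 1) * p - 1) / real n \<le> real (b n) / real n"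
        using b_lo by (intro divide_right_mono) auto
      then show "(real (a n) / real n + 1 / real n) * p - 1 / real n \<le> real (b n) / real n"
        by (simp add: diff_divide_distrib add_divide_distrib distrib_right)
    qed
    show "eventually (\<lambda>n. real (b n) / real n \<le> (real (a n) / real n + 1 / real n) * p) sequentially"
    proof (intro always_eventually allI)
      fix n
      have "real (b n) / real n \<le> ((real (a n) + 1) * p) / real n"
        using b_hi by (intro divide_right_mono) auto
      then show "real (b n) / real n \<le> (real (a n) / real n + 1 / real n) * p"
        by (simp add: diff_divide_distrib add_divide_distrib distrib_right)
    qed
    show "(\<lambda>n. (real (a n) / real n + 1 / real n) * p - 1 / real n) \<longlonglongrightarrow> \<beta>"
      using tendsto_diff[OF tendsto_mult_right[OF tendsto_add[OF lim_a inv0], of p] inv0] \<beta> by simp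
    show "(\<lambda>n. (real (a n) / real n + 1 / real n) * p) \<longlonglongrightarrow> \<beta>"
      using tendsto_mult_right[OF tendsto_add[OF lim_a inv0], of p] \<beta> by simp
  qed

  \<comment> \<open>\<open>L n\<close> and \<open>M n\<close> are the logarithms of the Bernoulli
    weights at \<open>b n\<close>, for \<open>a n\<close> trials with parameter \<open>p\<close> and
    for \<open>n\<close> trials with parameter \<open>\<beta>\<close>.\<close>
  define L where "L n = real (b n) * log 2 p + (real (a n) - real (b n)) * log 2 (1 - p)" for n
  define M where "M n = real (b n) * log 2 \<beta> + (real n - real (b n)) * log 2 (1 - \<beta>)" for n
  have lim_L: "(\<lambda>n. L n / real n) \<longlonglongrightarrow> - (\<alpha> * bin_entropy p)"
  proof -
    have "(\<lambda>n. real (b n) / real n * log 2 p + (real (a n) / real n - real (b n) / real n) * log 2 (1 - p))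
        \<longlonglongrightarrow> \<beta> * log 2 p + (\<alpha> - \<beta>) * log 2 (1 - p)"
      by (intro tendsto_intros lim_a lim_b)
    moreover have "\<beta> * log 2 p + (\<alpha> - \<beta>) * log 2 (1 - p) = - (\<alpha> * bin_entropy p)"
      unfolding \<beta>(1) by (simp add: bin_entropy_eq algebra_simps)
    ultimately show ?thesis
      by (simp add: L_def add_divide_distrib diff_divide_distrib left_diff_distrib)
  qed
  have lim_M: "(\<lambda>n. M n / real n) \<longlonglongrightarrow> - bin_entropy \<beta>"
  proof -
    have one: "(\<lambda>n. real n / real n) \<longlonglongrightarrow> 1" by real_asymp
    \<comment> \<open>Keeping \<open>real n / real n\<close> instead of 1 makes the identity hold at
      \<open>n = 0\<close> too, where all quotients are 0.\<close>
    have eq: "M n / real n = real (b n) / real n * log 2 \<beta>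
        + (real n / real n - real (b n) / real n) * log 2 (1 - \<beta>)" for n
      by (cases "n = 0") (simp_all add: M_def add_divide_distrib diff_divide_distrib left_diff_distrib)
    have "(\<lambda>n. real (b n) / real n * log 2 \<beta> + (real n / real n - real (b n) / real n) * log 2 (1 - \<beta>))
        \<longlonglongrightarrow> \<beta> * log 2 \<beta> + (1 - \<beta>) * log 2 (1 - \<beta>)"
      by (intro tendsto_intros one lim_b)
    then show ?thesis
      unfolding eq by (simp add: bin_entropy_eq add.commute)
  qed

  \<comment> \<open>\<open>s n\<close> and \<open>t n\<close> will bound the logarithms of
    \<open>S_val\<close> and \<open>P_val\<close>. The summand \<open>log 2 (real n + 1)\<close> is
    the loss in the mode estimate and vanishes after division by \<open>n\<close>.\<close>
  define s where "s n = (1 + max (real (a n)) (real n - real (a n) - L n)) / real n" for n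
  define t where "t n = (log 2 (real n + 1) - M n + L n) / real n" for n
  have "s \<longlonglongrightarrow> max \<alpha> ((1 - \<alpha>) + \<alpha> * bin_entropy p)"
  proof -
    have one: "(\<lambda>n. real n / real n) \<longlonglongrightarrow> 1" by real_asymp
    have eq: "s n = 1 / real n
        + max (real (a n) / real n) (real n / real n - real (a n) / real n - L n / real n)" for n
    proof (cases "n = 0")
      case False
      then show ?thesis
        by (simp add: s_def add_divide_distrib diff_divide_distrib max_divide_distrib_right)
    qed (simp add: s_def)
    have "s \<longlonglongrightarrow> 0 + max \<alpha> (1 - \<alpha> - - (\<alpha> * bin_entropy p))"
      unfolding eq by (intro tendsto_intros inv0 one lim_a lim_L)
    then show ?thesis by simp
  qed
  then have ev_s: "eventually (\<lambda>n. s n < max \<alpha> ((1 - \<alpha>) + \<alpha> * bin_entropy p) + \<epsilon>) sequentially"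
    by (rule order_tendstoD) (use assms in simp)
  have "t \<longlonglongrightarrow> 0 - - bin_entropy \<beta> + - (\<alpha> * bin_entropy p)"
  proof -
    have "(\<lambda>n. log 2 (real n + 1) / real n) \<longlonglongrightarrow> 0" by real_asymp
    from tendsto_add[OF tendsto_diff[OF this lim_M] lim_L] show ?thesis
      by (simp add: t_def[abs_def] add_divide_distrib diff_divide_distrib)
  qed
  then have ev_t: "eventually (\<lambda>n. t n < bin_entropy \<beta> - \<alpha> * bin_entropy p + \<epsilon>) sequentially"
    by (rule order_tendstoD) (use assms in simp)
  from eventually_happens[OF eventually_conj[OF eventually_ge_at_top[of 1] eventually_conj[OF ev_s ev_t]]]
  obtain n where n: "1 \<le> n" and s: "s n < max \<alpha> ((1 - \<alpha>) + \<alpha> * bin_entropy p) + \<epsilon>"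
    and t: "t n < bin_entropy \<beta> - \<alpha> * bin_entropy p + \<epsilon>" by auto

  define F where "F = front_system n {1..a n} (b n)"
  have A: "{1..a n} \<subseteq> {1..n}" using a_le by simp
  have bn: "b n \<le> n" using b_le a_le order_trans by blast
  have "log 2 (real (card F)) \<le> 1 + max (real (a n)) (real n - real (a n) - L n)"
    using log_card_front_system_le[OF A, of "b n" p] b_le b_p1 p unfolding F_def L_def by simp
  moreover have "F \<noteq> {}" "finite F"
  proof -
    have "{} \<in> F" by (simp add: F_def front_system_def)
    then show "F \<noteq> {}" by blast
    show "finite F"
      by (rule finite_subset[of _ "Pow {1..n}"]) (auto simp: F_def front_system_def)
  qed
  ultimately have "log 2 (S_val n F) \<le> s n"
    by (simp add: log_S_val s_def divide_right_mono)
  then have S: "log 2 (S_val n F) \<le> max \<alpha> ((1 - \<alpha>) + \<alpha> * bin_entropy p) + \<epsilon>"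
    using s by simp

  have wM: "log 2 (binomial_prob n \<beta> (b n)) = log 2 (real (n choose b n)) + M n" "0 < binomial_prob n \<beta> (b n)"
    using log_binomial_prob[of \<beta> "b n" n] \<beta> bn b_\<beta>1 by (auto simp: M_def)
  have wL: "log 2 (binomial_prob (a n) p (b n)) = log 2 (real (a n choose b n)) + L n" "0 < binomial_prob (a n) p (b n)"
    using log_binomial_prob[of p "b n" "a n"] p b_le b_p1 by (auto simp: L_def)
  \<comment> \<open>That a single probability is at most 1 already bounds
    \<open>n choose b n\<close> from above sharply enough.\<close>
  have "binomial_prob n \<beta> (b n) \<le> 1" using \<beta> bn by (intro binomial_prob_le_1) auto
  then have "log 2 (binomial_prob n \<beta> (b n)) \<le> 0" using wM(2) by simp
  then have up: "log 2 (real (n choose b n)) \<le> - M n" using wM(1) by simp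
  \<comment> \<open>Since \<open>b n\<close> is a mode, the matching lower bound on
    \<open>a n choose b n\<close> loses only the factor \<open>a n + 1\<close>, enlarged to
    \<open>n + 1\<close> to fit \<open>t n\<close>.\<close>
  have "1 \<le> (real (a n) + 1) * binomial_prob (a n) p (b n)"
    using p b_le b_lo b_hi by (intro one_le_binomial_prob_mode) auto
  also have "\<dots> \<le> (real n + 1) * binomial_prob (a n) p (b n)"
    using a_le wL(2) by (intro mult_right_mono) auto
  finally have "0 \<le> log 2 ((real n + 1) * binomial_prob (a n) p (b n))" by simp
  also have "\<dots> = log 2 (real n + 1) + log 2 (binomial_prob (a n) p (b n))"
    using wL(2) by (intro log_mult_pos) auto
  finally have lo: "- L n - log 2 (real n + 1) \<le> log 2 (real (a n choose b n))"
    using wL(1) by simp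
  have chains: "0 < num_chains n F"
    "fact n / real (num_chains n F) \<le> real (n choose b n) / real (a n choose b n)"
    using fact_div_num_chains_front_system[OF A, of "b n"] b_le by (auto simp: F_def)
  have "log 2 (fact n / real (num_chains n F)) \<le> log 2 (real (n choose b n) / real (a n choose b n))"
    using chains by (intro log_mono) auto
  also have "\<dots> = log 2 (real (n choose b n)) - log 2 (real (a n choose b n))"
    using bn b_le[of n] by (intro log_divide_pos) auto
  also have "\<dots> \<le> log 2 (real n + 1) - M n + L n" using up lo by linarith
  finally have "log 2 (fact n / real (num_chains n F)) / real n \<le> t n"
    by (simp add: t_def divide_right_mono)
  then have "elg (P_val n F) \<le> ereal (bin_entropy \<beta> - \<alpha> * bin_entropy p + \<epsilon>)"
    using t chains(1) by (simp add: elg_P_val)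
  \<comment> \<open>The estimates produce the entropies of \<open>\<beta>\<close> and
    \<open>\<beta> / \<alpha>\<close>; the exchange identity converts them to the required
    form.\<close>
  then have P: "elg (P_val n F) \<le>
      ereal (bin_entropy \<alpha> - (1 - \<beta>) * bin_entropy ((\<alpha> - \<beta>) / (1 - \<beta>)) + \<epsilon>)"
    using bin_entropy_exchange[of \<beta> \<alpha>] assms \<beta>(2) by (simp add: p_def)
  show ?thesis
  proof (intro exI conjI)
    show "set_system n F" by (auto simp: set_system_def F_def front_system_def)
    show "regularly_self_intersecting n F"
      unfolding F_def using bn by (rule regularly_self_intersecting_front_system)
  qed (use n S P in \<open>auto simp: p_def\<close>)
qed

end
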